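(* Let $\mathcal{A}=\bigcup_p\Phi_p'$ be a unital strong algebra, with associated constants $d$ and $A_{p,q}$ (as defined in the context). Assume that the power series $\sum_{n=0}^\infty c_n z^n$ converges in the open disk with radius $R$. Then for any $a\in\mathcal{A}$ such that there exist $p,q$ with $p>q+d$ and $A_{p,q}\|a\|_q<R$, it holds that $$\sum_{n=0}^\infty c_n a^n\in\Phi_p'\subseteq\mathcal{A}.$$
   Context: A countably normed space $\Phi$ is a locally convex (complex) space whose topology is defined by a countable family of compatible norms $(\|\cdot\|_p)_{p\in\mathbb N}$, i.e. if a sequence that is Cauchy in both $\|\cdot\|_p$ and $\|\cdot\|_q$ converges to zero in one of these norms, then it converges to zero in the other; the sequence of norms is taken non-decreasing in $p$. $\Phi_p$ denotes the completion of $\Phi$ with respect to $\|\cdot\|_p$, so $\Phi_1\supseteq\Phi_2\supseteq\cdots$, and $\Phi$ is complete iff $\Phi=\bigcap_p\Phi_p$. $\Phi'$ is the dual of $\Phi$ and $\Phi_p'$ the Banach dual of $\Phi_p$, with norm $\|f\|_p=\sup_{\|x\|_p\le 1}|f(x)|$; then $\Phi_1'\subseteq\Phi_2'\subseteq\cdots$, $\Phi'=\bigcup_p\Phi_p'$, and these dual norms are non-increasing in $p$. Strong algebra: a dual $\mathcal A=\bigcup_p\Phi_p'$ of a complete reflexive countably normed space $\Phi$, which is moreover an algebra over $\mathbb C$, such that there exists a constant $d$ such that for any $q$ and any $p>q+d$ there exists a positive constant $A_{p,q}$ such that for any $a\in\Phi_q'$ and $b\in\Phi_p'$: $\|ab\|_p\le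 A_{p,q}\|a\|_q\|b\|_p$ and $\|ba\|_p\le A_{p,q}\|a\|_q\|b\|_p$. Unital means that $\mathcal A$ has a multiplicative unit $1$, and $a^0=1$. A condition such as $A_{p,q}\|a\|_q<R$ includes the requirement $a\in\Phi_q'$.
   Formalization: The formal theorem additionally assumes that the unit 1 lies in Φ_p' for the given p; without this the claim fails (e.g. c=(1,0,0,…), where the sum is a^0=1). Series with c_0=0 when 1 is not in Φ_p' are thus not covered. *)

theory Defs
  imports "HOL-Analysis.Analysis" "HOL-Library.Function_Algebras"
begin

definition is_cnorm :: "(complex \<Rightarrow> 'a::ab_group_add \<Rightarrow> 'a) \<Rightarrow> ('a \<Rightarrow> real) \<Rightarrow> bool" where
  "is_cnorm scl N \<longleftrightarrow>
     (\<forall>x. 0 \<le> N x) \<and> (\<forall>x. N x = 0 \<longleftrightarrow> x = 0) \<and>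
     (\<forall>x y. N (x + y) \<le> N x + N y) \<and> (\<forall>c x. N (scl c x) = cmod c * N x)"

definition norm_Cauchy :: "('a::ab_group_add \<Rightarrow> real) \<Rightarrow> (nat \<Rightarrow> 'a) \<Rightarrow> bool" where
  "norm_Cauchy N X \<longleftrightarrow> (\<forall>e>0. \<exists>M. \<forall>m\<ge>M. \<forall>n\<ge>M. N (X m - X n) < e)"

definition norm_LIMSEQ :: "('a::ab_group_add \<Rightarrow> real) \<Rightarrow> (nat \<Rightarrow> 'a) \<Rightarrow> 'a \<Rightarrow> bool" where
  "norm_LIMSEQ N X x \<longleftrightarrow> (\<lambda>n. N (X n - x)) \<longlonglongrightarrow> 0"

definition linear_form_on ::
    "(complex \<Rightarrow> 'b::plus \<Rightarrow> 'b) \<Rightarrow> 'b set \<Rightarrow> ('b \<Rightarrow> complex) \<Rightarrow> bool" where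
  "linear_form_on scl S f \<longleftrightarrow>
     (\<forall>x\<in>S. \<forall>y\<in>S. f (x + y) = f x + f y) \<and> (\<forall>c. \<forall>x\<in>S. f (scl c x) = c * f x)"

text \<open>
  The Banach dual of the completion of \<open>(\<Phi>, N)\<close>, each functional being identified with its
  restriction to \<open>\<Phi>\<close>, so that the duals belonging to different norms on \<open>\<Phi>\<close> all consist of
  functionals on \<open>\<Phi>\<close>. That this identification is a bijection preserving the dual norm is
  proved below in \<open>bij_betw_dual_of_completion\<close> and \<open>dual_norm_completion\<close>.
\<close>

definition banach_dual ::
    "(complex \<Rightarrow> 'a::ab_group_add \<Rightarrow> 'a) \<Rightarrow> ('a \<Rightarrow> real) \<Rightarrow> ('a \<Rightarrow> complex) set" where
  "banach_dual scl N = {f. linear_form_on scl UNIV f \<and> (\<exists>C. \<forall>x. cmod (f x) \<le> C * N x)}"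

definition dual_norm :: "('a \<Rightarrow> real) \<Rightarrow> ('a \<Rightarrow> complex) \<Rightarrow> real" where
  "dual_norm N f = (SUP x\<in>{x. N x \<le> 1}. cmod (f x))"

definition is_completion ::
    "(complex \<Rightarrow> 'a::ab_group_add \<Rightarrow> 'a) \<Rightarrow> ('a \<Rightarrow> real) \<Rightarrow>
     (complex \<Rightarrow> 'b::ab_group_add \<Rightarrow> 'b) \<Rightarrow> ('b \<Rightarrow> real) \<Rightarrow> ('a \<Rightarrow> 'b) \<Rightarrow> bool" where
  "is_completion scl N scl' N' \<iota> \<longleftrightarrow>
     vector_space scl' \<and> is_cnorm scl' N' \<and>
     (\<forall>Y. norm_Cauchy N' Y \<longrightarrow> (\<exists>y. norm_LIMSEQ N' Y y)) \<and>
     Vector_Spaces.linear scl scl' \<iota> \<and> (\<forall>x. N' (\<iota> x) = N x) \<and>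
     (\<forall>y. \<forall>e>0. \<exists>x. N' (y - \<iota> x) < e)"

definition seminorm_topology :: "'b::minus set \<Rightarrow> ('b \<Rightarrow> real) set \<Rightarrow> 'b topology" where
  "seminorm_topology S P =
     topology_generated_by {{y \<in> S. s (y - x) < e} | s x e. s \<in> P \<and> x \<in> S \<and> 0 < e}"

text \<open>
  Functionals on a carrier \<open>S\<close> are made unique outside \<open>S\<close> by \<^const>\<open>extensional\<close>,
  which imposes nothing when \<open>S\<close> is \<^const>\<open>UNIV\<close>.
\<close>

definition lc_dual ::
    "(complex \<Rightarrow> 'b::{plus,minus} \<Rightarrow> 'b) \<Rightarrow> 'b set \<Rightarrow> ('b \<Rightarrow> real) set \<Rightarrow> ('b \<Rightarrow> complex) set" where
  "lc_dual scl S P =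
     {f \<in> extensional S. linear_form_on scl S f \<and>
        continuous_map (seminorm_topology S P) euclidean f}"

definition lc_bounded :: "'b set \<Rightarrow> ('b \<Rightarrow> real) set \<Rightarrow> 'b set \<Rightarrow> bool" where
  "lc_bounded S P B \<longleftrightarrow> B \<subseteq> S \<and> (\<forall>s\<in>P. \<exists>C. \<forall>x\<in>B. s x \<le> C)"

text \<open>
  The seminorms of uniform convergence on bounded sets, defining the strong topology of the dual.
  The empty set is left out because the supremum of the empty set of reals is unspecified.
\<close>

definition strong_seminorms :: "'b set \<Rightarrow> ('b \<Rightarrow> real) set \<Rightarrow> (('b \<Rightarrow> complex) \<Rightarrow> real) set" where
  "strong_seminorms S P = {(\<lambda>f. SUP x\<in>B. cmod (f x)) | B. lc_bounded S P B \<and> B \<noteq> {}}"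

definition fscale :: "complex \<Rightarrow> ('a \<Rightarrow> complex) \<Rightarrow> 'a \<Rightarrow> complex" where
  "fscale c f = (\<lambda>x. c * f x)"

text \<open>
  Reflexivity of the locally convex space with seminorms \<open>P\<close>: evaluation is a homeomorphism
  onto the bidual, both the dual and the bidual carrying their strong topologies.
\<close>

definition lc_reflexive ::
    "(complex \<Rightarrow> 'a::ab_group_add \<Rightarrow> 'a) \<Rightarrow> ('a \<Rightarrow> real) set \<Rightarrow> bool" where
  "lc_reflexive scl P \<longleftrightarrow>
     (let D = lc_dual scl UNIV P; Q = strong_seminorms UNIV P in
      homeomorphic_map
        (seminorm_topology UNIV P)
        (seminorm_topology (lc_dual fscale D Q) (strong_seminorms D Q))
        (\<lambda>x. restrict (\<lambda>f. f x) D))"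

locale countably_normed_space = vector_space scale
  for scale :: "complex \<Rightarrow> 'a::ab_group_add \<Rightarrow> 'a" +
  fixes N :: "nat \<Rightarrow> 'a \<Rightarrow> real"
  assumes is_cnorm: "is_cnorm scale (N p)"
    and norm_mono: "p \<le> q \<Longrightarrow> N p x \<le> N q x"
    and compatible:
      "\<lbrakk>norm_Cauchy (N p) X; norm_Cauchy (N q) X; norm_LIMSEQ (N p) X 0\<rbrakk>
        \<Longrightarrow> norm_LIMSEQ (N q) X 0"

definition cn_complete :: "(nat \<Rightarrow> 'a::ab_group_add \<Rightarrow> real) \<Rightarrow> bool" where
  "cn_complete N \<longleftrightarrow>
     (\<forall>X. (\<forall>p. norm_Cauchy (N p) X) \<longrightarrow> (\<exists>x. \<forall>p. norm_LIMSEQ (N p) X x))"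

definition cn_dual ::
    "(complex \<Rightarrow> 'a::ab_group_add \<Rightarrow> 'a) \<Rightarrow> (nat \<Rightarrow> 'a \<Rightarrow> real) \<Rightarrow> ('a \<Rightarrow> complex) set" where
  "cn_dual scl N = lc_dual scl UNIV (range N)"

text \<open>
  The linear structure of the algebra is the pointwise one of the dual space; \<open>mult\<close> is only
  relevant on the dual of \<open>\<Phi>\<close>. The inequalities are read as including that the
  products lie in the \<open>p\<close>-th Banach dual, since \<^const>\<open>dual_norm\<close> has no meaning elsewhere.
\<close>

locale strong_algebra = countably_normed_space scale N
  for scale :: "complex \<Rightarrow> 'a::ab_group_add \<Rightarrow> 'a" and N :: "nat \<Rightarrow> 'a \<Rightarrow> real" +
  fixes mult :: "('a \<Rightarrow> complex) \<Rightarrow> ('a \<Rightarrow> complex) \<Rightarrow> ('a \<Rightarrow> complex)"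
    and d :: real
    and A :: "nat \<Rightarrow> nat \<Rightarrow> real"
  assumes complete: "cn_complete N"
    and reflexive: "lc_reflexive scale (range N)"
    and mult_closed:
      "\<lbrakk>f \<in> cn_dual scale N; g \<in> cn_dual scale N\<rbrakk> \<Longrightarrow> mult f g \<in> cn_dual scale N"
    and mult_assoc:
      "\<lbrakk>f \<in> cn_dual scale N; g \<in> cn_dual scale N; h \<in> cn_dual scale N\<rbrakk>
        \<Longrightarrow> mult (mult f g) h = mult f (mult g h)"
    and mult_add_left:
      "\<lbrakk>f \<in> cn_dual scale N; g \<in> cn_dual scale N; h \<in> cn_dual scale N\<rbrakk>
        \<Longrightarrow> mult (f + g) h = mult f h + mult g h"
    and mult_add_right:
      "\<lbrakk>f \<in> cn_dual scale N; g \<in> cn_dual scale N; h \<in> cn_dual scale N\<rbrakk>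
        \<Longrightarrow> mult f (g + h) = mult f g + mult f h"
    and mult_scale_left:
      "\<lbrakk>f \<in> cn_dual scale N; g \<in> cn_dual scale N\<rbrakk>
        \<Longrightarrow> mult (fscale z f) g = fscale z (mult f g)"
    and mult_scale_right:
      "\<lbrakk>f \<in> cn_dual scale N; g \<in> cn_dual scale N\<rbrakk>
        \<Longrightarrow> mult f (fscale z g) = fscale z (mult f g)"
    and A_pos: "real p > real q + d \<Longrightarrow> A p q > 0"
    and mult_le:
      "\<lbrakk>real p > real q + d; f \<in> banach_dual scale (N q); g \<in> banach_dual scale (N p)\<rbrakk>
        \<Longrightarrow> mult f g \<in> banach_dual scale (N p) \<and>
            dual_norm (N p) (mult f g) \<le> A p q * dual_norm (N q) f * dual_norm (N p) g"
    and mult_le':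
      "\<lbrakk>real p > real q + d; f \<in> banach_dual scale (N q); g \<in> banach_dual scale (N p)\<rbrakk>
        \<Longrightarrow> mult g f \<in> banach_dual scale (N p) \<and>
            dual_norm (N p) (mult g f) \<le> A p q * dual_norm (N q) f * dual_norm (N p) g"

locale unital_strong_algebra = strong_algebra scale N mult d A
  for scale :: "complex \<Rightarrow> 'a::ab_group_add \<Rightarrow> 'a" and N :: "nat \<Rightarrow> 'a \<Rightarrow> real"
    and mult :: "('a \<Rightarrow> complex) \<Rightarrow> ('a \<Rightarrow> complex) \<Rightarrow> ('a \<Rightarrow> complex)"
    and d :: real and A :: "nat \<Rightarrow> nat \<Rightarrow> real" +
  fixes unit :: "'a \<Rightarrow> complex"
  assumes unit_closed: "unit \<in> cn_dual scale N"
    and mult_unit_left: "f \<in> cn_dual scale N \<Longrightarrow> mult unit f = f"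
    and mult_unit_right: "f \<in> cn_dual scale N \<Longrightarrow> mult f unit = f"

primrec alg_power ::
    "('b \<Rightarrow> 'b \<Rightarrow> 'b) \<Rightarrow> 'b \<Rightarrow> 'b \<Rightarrow> nat \<Rightarrow> 'b" where
  "alg_power m u a 0 = u"
| "alg_power m u a (Suc n) = m a (alg_power m u a n)"

definition banach_dual_sums ::
    "(complex \<Rightarrow> 'a::ab_group_add \<Rightarrow> 'a) \<Rightarrow> ('a \<Rightarrow> real) \<Rightarrow>
     (nat \<Rightarrow> 'a \<Rightarrow> complex) \<Rightarrow> ('a \<Rightarrow> complex) \<Rightarrow> bool" where
  "banach_dual_sums scl N t s \<longleftrightarrow>
     (\<forall>n. t n \<in> banach_dual scl N) \<and> s \<in> banach_dual scl N \<and>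
     norm_LIMSEQ (dual_norm N) (\<lambda>n. \<Sum>k<n. t k) s"

lemma cnormD:
  assumes "is_cnorm scl N"
  shows "0 \<le> N x" "N x = 0 \<longleftrightarrow> x = 0" "N (x + y) \<le> N x + N y" "N (scl c x) = cmod c * N x"
  using assms unfolding is_cnorm_def by blast+

lemma cnorm_minus:
  assumes "vector_space scl" "is_cnorm scl N"
  shows "N (x - y) = N (y - x)"
proof -
  interpret vector_space scl by fact
  have "N (scl (- 1) (x - y)) = cmod (- 1) * N (x - y)"
    by (rule cnormD(4)[OF assms(2)])
  then show ?thesis by simp
qed

lemma cnorm_triangle:
  assumes "is_cnorm scl N"
  shows "N (x - z) \<le> N (x - y) + N (y - z)"
  using cnormD(3)[OF assms, of "x - y" "y - z"] by simp

lemma linear_form_diff: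
  assumes "linear_form_on scl UNIV f"
  shows "f (x - y) = f x - f (y::'a::ab_group_add)"
proof -
  have "f (x - y + y) = f (x - y) + f y"
    using assms unfolding linear_form_on_def by blast
  then show ?thesis by simp
qed

lemma banach_dual_bound:
  assumes "is_cnorm scl N" "f \<in> banach_dual scl N"
  obtains C where "C > 0" "\<And>x. cmod (f x) \<le> C * N x"
proof -
  obtain C where C: "\<And>x. cmod (f x) \<le> C * N x"
    using assms(2) unfolding banach_dual_def by blast
  have "cmod (f x) \<le> (\<bar>C\<bar> + 1) * N x" for x
    by (rule order_trans[OF C]) (intro mult_right_mono, auto simp: cnormD(1)[OF assms(1)])
  then show thesis by (intro that[of "\<bar>C\<bar> + 1"]) auto
qed

lemma bdd_above_dual_norm:
  assumes "is_cnorm scl N" "f \<in> banach_dual scl N"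
  shows "bdd_above ((\<lambda>x. cmod (f x)) ` {x. N x \<le> 1})"
proof -
  obtain C where C: "C > 0" "\<And>x. cmod (f x) \<le> C * N x"
    using banach_dual_bound[OF assms] by blast
  have "cmod (f x) \<le> C" if "N x \<le> 1" for x
    using C(2)[of x] mult_left_mono[OF that, of C] C(1) by linarith
  then show ?thesis by (intro bdd_aboveI2[of _ _ C]) auto
qed

lemma cmod_le_dual_norm:
  assumes "vector_space scl" "is_cnorm scl N" "f \<in> banach_dual scl N"
  shows "cmod (f x) \<le> dual_norm N f * N x"
proof (cases "N x = 0")
  case True
  obtain C where "\<And>x. cmod (f x) \<le> C * N x"
    using banach_dual_bound[OF assms(2,3)] by blast
  from this[of x] True show ?thesis by simp
next
  case False
  then have pos: "N x > 0"
    using cnormD(1)[OF assms(2), of x] by linarith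
  let ?y = "scl (complex_of_real (1 / N x)) x"
  have "N ?y = cmod (complex_of_real (1 / N x)) * N x"
    by (rule cnormD(4)[OF assms(2)])
  also have "\<dots> = 1"
    using pos by (simp add: norm_divide)
  finally have y: "N ?y \<le> 1" by simp
  have "cmod (f ?y) \<le> dual_norm N f"
    unfolding dual_norm_def using y bdd_above_dual_norm[OF assms(2,3)]
    by (intro cSUP_upper) auto
  moreover have "f ?y = complex_of_real (1 / N x) * f x"
    using assms(3) unfolding banach_dual_def linear_form_on_def by blast
  then have "cmod (f ?y) = cmod (f x) / N x"
    using pos by (simp add: norm_mult norm_divide)
  ultimately show ?thesis
    using pos by (simp add: pos_divide_le_eq)
qed

lemma dual_norm_le:
  assumes "\<And>x. cmod (f x) \<le> C * N x" "0 \<le> C" "N x0 \<le> 1"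
  shows "dual_norm N f \<le> C"
  unfolding dual_norm_def
proof (rule cSUP_least)
  show "{x. N x \<le> 1} \<noteq> {}" using assms(3) by blast
  show "cmod (f x) \<le> C" if "x \<in> {x. N x \<le> 1}" for x
  proof -
    have "N x \<le> 1" using that by simp
    then show ?thesis
      using assms(1)[of x] mult_left_mono[of "N x" 1 C] assms(2) by linarith
  qed
qed

context
  fixes scl :: "complex \<Rightarrow> 'a::ab_group_add \<Rightarrow> 'a" and N
    and scl' :: "complex \<Rightarrow> 'b::ab_group_add \<Rightarrow> 'b" and N' \<iota>
  assumes N: "is_cnorm scl N" and comp: "is_completion scl N scl' N' \<iota>"
begin

lemma completion_facts:
  shows completion_vector_space: "vector_space scl'" and completion_cnorm: "is_cnorm scl' N'"
    and completion_linear: "Vector_Spaces.linear scl scl' \<iota>"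
    and completion_iso: "N' (\<iota> x) = N x"
    and completion_dense: "e > 0 \<Longrightarrow> \<exists>x. N' (y - \<iota> x) < e"
  using comp unfolding is_completion_def by auto

lemma completion_base_vs: "vector_space scl"
  using completion_linear by (simp add: Vector_Spaces.linear_def)

lemma completion_hom: "\<iota> (x + y) = \<iota> x + \<iota> y" "\<iota> (scl c x) = scl' c (\<iota> x)" "\<iota> (x - y) = \<iota> x - \<iota> y"
proof -
  interpret Vector_Spaces.linear scl scl' \<iota> by (rule completion_linear)
  show "\<iota> (x + y) = \<iota> x + \<iota> y" "\<iota> (scl c x) = scl' c (\<iota> x)" "\<iota> (x - y) = \<iota> x - \<iota> y"
    by (simp_all add: add scale diff)
qed

lemma completion_restrict:
  assumes "F \<in> banach_dual scl' N'"
  shows "F \<circ> \<iota> \<in> banach_dual scl N"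
proof -
  obtain C where "\<And>x. cmod (F x) \<le> C * N' x"
    using banach_dual_bound[OF completion_cnorm assms] by blast
  then have "\<And>x. cmod (F (\<iota> x)) \<le> C * N x" using completion_iso by metis
  then show ?thesis
    using assms unfolding banach_dual_def linear_form_on_def by (auto simp: completion_hom)
qed

lemma completion_approx:
  obtains X where "(\<lambda>n. N' (y - \<iota> (X n))) \<longlonglongrightarrow> 0"
proof -
  have "\<forall>n. \<exists>x. N' (y - \<iota> x) < inverse (real (Suc n))"
    using completion_dense by simp
  then obtain X where X: "\<And>n. N' (y - \<iota> (X n)) < inverse (real (Suc n))" by metis
  have "(\<lambda>n. N' (y - \<iota> (X n))) \<longlonglongrightarrow> 0"
    by (rule tendsto_sandwich[OF _ _ tendsto_const LIMSEQ_inverse_real_of_nat])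
      (use less_imp_le[OF X] in \<open>auto intro!: always_eventually simp: cnormD(1)[OF completion_cnorm]\<close>)
  then show thesis by (rule that)
qed

lemma completion_dual_tendsto:
  assumes "F \<in> banach_dual scl' N'" "(\<lambda>n. N' (y - \<iota> (X n))) \<longlonglongrightarrow> 0"
  shows "(\<lambda>n. F (\<iota> (X n))) \<longlonglongrightarrow> F y"
proof -
  obtain C where C: "\<And>x. cmod (F x) \<le> C * N' x"
    using banach_dual_bound[OF completion_cnorm assms(1)] by blast
  have lF: "linear_form_on scl' UNIV F" using assms(1) unfolding banach_dual_def by blast
  have le: "cmod (F (\<iota> (X n)) - F y) \<le> C * N' (y - \<iota> (X n))" for n
    using C[of "y - \<iota> (X n)"] by (simp add: linear_form_diff[OF lF] norm_minus_commute)
  have "(\<lambda>n. C * N' (y - \<iota> (X n))) \<longlonglongrightarrow> 0"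
    using tendsto_mult_left[OF assms(2), of C] by simp
  then have "(\<lambda>n. F (\<iota> (X n)) - F y) \<longlonglongrightarrow> 0"
    by (rule Lim_null_comparison[rotated]) (simp add: le)
  then show ?thesis by (simp add: LIM_zero_iff)
qed

lemma completion_extend:
  assumes f: "f \<in> banach_dual scl N"
  obtains F where "F \<in> banach_dual scl' N'" "F \<circ> \<iota> = f"
proof -
  obtain C where C: "C > 0" "\<And>x. cmod (f x) \<le> C * N x"
    using banach_dual_bound[OF N f] by blast
  have lf: "linear_form_on scl UNIV f" using f unfolding banach_dual_def by blast
  have "\<exists>l. \<forall>X. (\<lambda>n. N' (y - \<iota> (X n))) \<longlonglongrightarrow> 0 \<longrightarrow> (\<lambda>n. f (X n)) \<longlonglongrightarrow> l" for y
  proof -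
    obtain X where X: "(\<lambda>n. N' (y - \<iota> (X n))) \<longlonglongrightarrow> 0" by (rule completion_approx)
    have key: "cmod (f x - f x') \<le> C * (N' (y - \<iota> x) + N' (y - \<iota> x'))" for x x'
    proof -
      have "cmod (f x - f x') \<le> C * N (x - x')"
        using C(2)[of "x - x'"] by (simp add: linear_form_diff[OF lf])
      also have "N (x - x') = N' (\<iota> x - \<iota> x')" by (simp only: completion_iso flip: completion_hom(3))
      also have "\<dots> \<le> N' (\<iota> x - y) + N' (y - \<iota> x')" by (rule cnorm_triangle[OF completion_cnorm])
      also have "N' (\<iota> x - y) = N' (y - \<iota> x)" by (rule cnorm_minus[OF completion_vector_space completion_cnorm])
      finally show ?thesis using C(1) by simp
    qed
    have "Cauchy (\<lambda>n. f (X n))"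
    proof (rule CauchyI)
      fix e :: real assume "e > 0"
      then have "eventually (\<lambda>n. N' (y - \<iota> (X n)) < e / (2 * C)) sequentially"
        using C(1) by (intro order_tendstoD(2)[OF X]) simp
      then obtain M where M: "\<And>n. n \<ge> M \<Longrightarrow> N' (y - \<iota> (X n)) < e / (2 * C)"
        by (auto simp: eventually_sequentially)
      have "cmod (f (X m) - f (X n)) < e" if "m \<ge> M" "n \<ge> M" for m n
      proof -
        have "N' (y - \<iota> (X m)) + N' (y - \<iota> (X n)) < e / C"
          using M[OF that(1)] M[OF that(2)] C(1) by (simp add: field_simps)
        then have "C * (N' (y - \<iota> (X m)) + N' (y - \<iota> (X n))) < e"
          using C(1) by (simp add: field_simps)
        then show ?thesis using key[of "X m" "X n"] by linarith
      qed
      then show "\<exists>M. \<forall>m\<ge>M. \<forall>n\<ge>M. cmod (f (X m) - f (X n)) < e" by blast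
    qed
    then obtain l where l: "(\<lambda>n. f (X n)) \<longlonglongrightarrow> l"
      using Cauchy_convergent_iff convergent_def by blast
    have "(\<lambda>n. f (Z n)) \<longlonglongrightarrow> l" if Z: "(\<lambda>n. N' (y - \<iota> (Z n))) \<longlonglongrightarrow> 0" for Z
    proof -
      have "(\<lambda>n. C * (N' (y - \<iota> (Z n)) + N' (y - \<iota> (X n)))) \<longlonglongrightarrow> 0"
        using tendsto_mult_left[OF tendsto_add[OF Z X], of C] by simp
      then have "(\<lambda>n. f (Z n) - f (X n)) \<longlonglongrightarrow> 0"
        by (rule Lim_null_comparison[rotated]) (simp add: key)
      from tendsto_add[OF this l] show ?thesis by simp
    qed
    then show ?thesis by blast
  qed
  then obtain F where F: "\<And>y X. (\<lambda>n. N' (y - \<iota> (X n))) \<longlonglongrightarrow> 0 \<Longrightarrow> (\<lambda>n. f (X n)) \<longlonglongrightarrow> F y"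
    by metis
  have F\<iota>: "F (\<iota> x) = f x" for x
  proof -
    have "N' (\<iota> x - \<iota> x) = 0" using cnormD(2)[OF completion_cnorm, of 0] by simp
    then have "(\<lambda>n. f x) \<longlonglongrightarrow> F (\<iota> x)"
      by (intro F[of "\<iota> x" "\<lambda>_. x"]) simp
    then show ?thesis by (simp add: LIMSEQ_const_iff)
  qed
  have add: "F (y + z) = F y + F z" for y z
  proof -
    obtain Y where Y: "(\<lambda>n. N' (y - \<iota> (Y n))) \<longlonglongrightarrow> 0" by (rule completion_approx)
    obtain Z where Z: "(\<lambda>n. N' (z - \<iota> (Z n))) \<longlonglongrightarrow> 0" by (rule completion_approx)
    have le: "N' (y + z - \<iota> (Y n + Z n)) \<le> N' (y - \<iota> (Y n)) + N' (z - \<iota> (Z n))" for n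
      using cnormD(3)[OF completion_cnorm, of "y - \<iota> (Y n)" "z - \<iota> (Z n)"] by (simp add: completion_hom algebra_simps)
    have "(\<lambda>n. N' (y + z - \<iota> (Y n + Z n))) \<longlonglongrightarrow> 0"
    proof (rule tendsto_sandwich[OF _ _ tendsto_const])
      show "(\<lambda>n. N' (y - \<iota> (Y n)) + N' (z - \<iota> (Z n))) \<longlonglongrightarrow> 0"
        using tendsto_add[OF Y Z] by simp
    qed (simp_all add: le cnormD(1)[OF completion_cnorm])
    from F[OF this] have "(\<lambda>n. f (Y n) + f (Z n)) \<longlonglongrightarrow> F (y + z)"
      using lf unfolding linear_form_on_def by simp
    from LIMSEQ_unique[OF this tendsto_add[OF F[OF Y] F[OF Z]]] show ?thesis .
  qed
  have scale: "F (scl' c y) = c * F y" for c y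
  proof -
    obtain Y where Y: "(\<lambda>n. N' (y - \<iota> (Y n))) \<longlonglongrightarrow> 0" by (rule completion_approx)
    have "N' (scl' c y - \<iota> (scl c (Y n))) = cmod c * N' (y - \<iota> (Y n))" for n
      using cnormD(4)[OF completion_cnorm, of c "y - \<iota> (Y n)"] module.scale_right_diff_distrib[OF
          completion_vector_space[unfolded vector_space_def module_def[symmetric]], of c y "\<iota> (Y n)"]
      by (simp add: completion_hom)
    then have "(\<lambda>n. N' (scl' c y - \<iota> (scl c (Y n)))) \<longlonglongrightarrow> 0"
      using tendsto_mult_left[OF Y, of "cmod c"] by simp
    from F[OF this] have "(\<lambda>n. c * f (Y n)) \<longlonglongrightarrow> F (scl' c y)"
      using lf unfolding linear_form_on_def by simp
    from LIMSEQ_unique[OF this tendsto_mult_left[OF F[OF Y]]] show ?thesis .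
  qed
  have bound: "cmod (F y) \<le> C * N' y" for y
  proof -
    obtain Y where Y: "(\<lambda>n. N' (y - \<iota> (Y n))) \<longlonglongrightarrow> 0" by (rule completion_approx)
    have "cmod (f (Y n)) \<le> C * (N' (y - \<iota> (Y n)) + N' y)" for n
    proof -
      have "N (Y n) = N' (\<iota> (Y n) - 0)" by (simp add: completion_iso)
      also have "\<dots> \<le> N' (\<iota> (Y n) - y) + N' (y - 0)" by (rule cnorm_triangle[OF completion_cnorm])
      also have "N' (\<iota> (Y n) - y) = N' (y - \<iota> (Y n))" by (rule cnorm_minus[OF completion_vector_space completion_cnorm])
      finally have "C * N (Y n) \<le> C * (N' (y - \<iota> (Y n)) + N' y)" using C(1) by simp
      then show ?thesis using C(2)[of "Y n"] by linarith
    qed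
    moreover have "(\<lambda>n. C * (N' (y - \<iota> (Y n)) + N' y)) \<longlonglongrightarrow> C * (0 + N' y)"
      by (intro tendsto_intros Y)
    moreover have "(\<lambda>n. cmod (f (Y n))) \<longlonglongrightarrow> cmod (F y)"
      by (intro tendsto_norm F Y)
    ultimately have "cmod (F y) \<le> C * (0 + N' y)"
      by (intro LIMSEQ_le) auto
    then show ?thesis by simp
  qed
  have "F \<in> banach_dual scl' N'"
    unfolding banach_dual_def linear_form_on_def using add scale bound by blast
  moreover have "F \<circ> \<iota> = f" using F\<iota> by auto
  ultimately show thesis by (rule that)
qed

theorem bij_betw_dual_of_completion:
  "bij_betw (\<lambda>F. F \<circ> \<iota>) (banach_dual scl' N') (banach_dual scl N)"
proof (rule bij_betw_imageI)
  show "inj_on (\<lambda>F. F \<circ> \<iota>) (banach_dual scl' N')"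
  proof (intro inj_onI ext)
    fix F G y assume FG: "F \<in> banach_dual scl' N'" "G \<in> banach_dual scl' N'" "F \<circ> \<iota> = G \<circ> \<iota>"
    obtain Y where Y: "(\<lambda>n. N' (y - \<iota> (Y n))) \<longlonglongrightarrow> 0" by (rule completion_approx)
    have "F (\<iota> x) = G (\<iota> x)" for x using FG(3) by (metis comp_apply)
    with completion_dual_tendsto[OF FG(1) Y] completion_dual_tendsto[OF FG(2) Y] show "F y = G y"
      by (simp add: LIMSEQ_unique)
  qed
  show "(\<lambda>F. F \<circ> \<iota>) ` banach_dual scl' N' = banach_dual scl N"
  proof (intro equalityI subsetI)
    fix f assume "f \<in> banach_dual scl N"
    then obtain F where "F \<in> banach_dual scl' N'" "F \<circ> \<iota> = f" by (rule completion_extend)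
    then show "f \<in> (\<lambda>F. F \<circ> \<iota>) ` banach_dual scl' N'" by blast
  qed (use completion_restrict in blast)
qed

theorem dual_norm_completion:
  assumes F: "F \<in> banach_dual scl' N'"
  shows "dual_norm N (F \<circ> \<iota>) = dual_norm N' F"
proof (rule antisym)
  have z: "N' 0 = 0" "N 0 = 0" using cnormD(2)[OF completion_cnorm] cnormD(2)[OF N] by auto
  have nn: "0 \<le> dual_norm N' F"
    unfolding dual_norm_def
    by (rule cSUP_upper2[where x = 0]) (use bdd_above_dual_norm[OF completion_cnorm F] z in auto)
  have nn': "0 \<le> dual_norm N (F \<circ> \<iota>)"
    unfolding dual_norm_def
    by (rule cSUP_upper2[where x = 0])
      (use bdd_above_dual_norm[OF N completion_restrict[OF F]] z in auto)
  have "cmod (F (\<iota> x)) \<le> dual_norm N' F * N x" for x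
    using cmod_le_dual_norm[OF completion_vector_space completion_cnorm F, of "\<iota> x"] by (simp add: completion_iso)
  then show "dual_norm N (F \<circ> \<iota>) \<le> dual_norm N' F"
    using nn z by (intro dual_norm_le[where ?x0.0 = 0]) auto
  have "cmod (F y) \<le> dual_norm N (F \<circ> \<iota>) * N' y" for y
  proof -
    let ?D = "dual_norm N (F \<circ> \<iota>)"
    obtain Y where Y: "(\<lambda>n. N' (y - \<iota> (Y n))) \<longlonglongrightarrow> 0" by (rule completion_approx)
    have "cmod (F (\<iota> (Y n))) \<le> ?D * (N' (y - \<iota> (Y n)) + N' y)" for n
    proof -
      have "N (Y n) = N' (\<iota> (Y n) - 0)" by (simp add: completion_iso)
      also have "\<dots> \<le> N' (\<iota> (Y n) - y) + N' (y - 0)" by (rule cnorm_triangle[OF completion_cnorm])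
      also have "N' (\<iota> (Y n) - y) = N' (y - \<iota> (Y n))" by (rule cnorm_minus[OF completion_vector_space completion_cnorm])
      finally have "?D * N (Y n) \<le> ?D * (N' (y - \<iota> (Y n)) + N' y)"
        using nn' by (simp add: mult_left_mono)
      then show ?thesis
        using cmod_le_dual_norm[OF completion_base_vs N completion_restrict[OF F], of "Y n"] by simp
    qed
    moreover have "(\<lambda>n. ?D * (N' (y - \<iota> (Y n)) + N' y)) \<longlonglongrightarrow> ?D * (0 + N' y)"
      by (intro tendsto_intros Y)
    moreover have "(\<lambda>n. cmod (F (\<iota> (Y n)))) \<longlonglongrightarrow> cmod (F y)"
      by (intro tendsto_norm completion_dual_tendsto F Y)
    ultimately have "cmod (F y) \<le> ?D * (0 + N' y)"
      by (intro LIMSEQ_le) auto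
    then show ?thesis by simp
  qed
  then show "dual_norm N' F \<le> dual_norm N (F \<circ> \<iota>)"
    using nn' z by (intro dual_norm_le[where ?x0.0 = 0]) auto
qed

end

context countably_normed_space
begin

lemma openin_ball:
  assumes "e > 0"
  shows "openin (seminorm_topology UNIV (range N)) {y. N p (y - x) < e}"
  unfolding seminorm_topology_def openin_topology_generated_by_iff
  by (rule generate_topology_on.Basis) (use assms in blast)

lemma centre_in_ball: "e > 0 \<Longrightarrow> x \<in> {y. N p (y - x) < e}"
  using cnormD(2)[OF is_cnorm, of p 0] by simp

lemma topspace_seminorm_topology: "topspace (seminorm_topology UNIV (range N)) = UNIV"
proof -
  have "x \<in> topspace (seminorm_topology UNIV (range N))" for x
    using openin_subset[OF openin_ball[of 1 0 x]] centre_in_ball[of 1 x 0] by auto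
  then show ?thesis by blast
qed

lemma seminorm_open_contains_ball:
  assumes U: "openin (seminorm_topology UNIV (range N)) U" and x: "x \<in> U"
  shows "\<exists>p e. e > 0 \<and> {y. N p (y - x) < e} \<subseteq> U"
proof -
  define \<B> where
    "\<B> = {{y \<in> UNIV. s (y - x) < e} | s x e. s \<in> range N \<and> x \<in> UNIV \<and> 0 < (e::real)}"
  have "generate_topology_on \<B> U"
    using U unfolding seminorm_topology_def openin_topology_generated_by_iff \<B>_def .
  then have "\<forall>x\<in>U. \<exists>p e. e > 0 \<and> {y. N p (y - x) < e} \<subseteq> U"
  proof (induct rule: generate_topology_on.induct)
    case Empty
    show ?case by simp
  next
    case (Int a b)
    show ?case
    proof
      fix x assume "x \<in> a \<inter> b"
      then obtain p e q e' where *: "e > 0" "{y. N p (y - x) < e} \<subseteq> a"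
          "e' > 0" "{y. N q (y - x) < e'} \<subseteq> b" using Int(2,4) by fast
      have "{y. N (max p q) (y - x) < min e e'} \<subseteq> a \<inter> b"
      proof
        fix y assume "y \<in> {y. N (max p q) (y - x) < min e e'}"
        then have "N p (y - x) < e" "N q (y - x) < e'"
          using norm_mono[of p "max p q" "y - x"] norm_mono[of q "max p q" "y - x"] by auto
        then show "y \<in> a \<inter> b" using * by blast
      qed
      moreover have "min e e' > 0" using * by simp
      ultimately show "\<exists>p e. e > 0 \<and> {y. N p (y - x) < e} \<subseteq> a \<inter> b" by blast
    qed
  next
    case (UN K)
    show ?case
    proof
      fix x assume "x \<in> \<Union>K"
      then obtain k where k: "k \<in> K" "x \<in> k" by blast
      then obtain p e where "e > 0" "{y. N p (y - x) < e} \<subseteq> k" using UN(2) by blast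
      then show "\<exists>p e. e > 0 \<and> {y. N p (y - x) < e} \<subseteq> \<Union>K" using k(1) by blast
    qed
  next
    case (Basis s)
    then obtain p z e where s: "s = {y. N p (y - z) < e}" "e > 0" unfolding \<B>_def by auto
    show ?case
    proof
      fix x assume "x \<in> s"
      then have "e - N p (x - z) > 0" using s by simp
      moreover have "{y. N p (y - x) < e - N p (x - z)} \<subseteq> s"
      proof
        fix y assume "y \<in> {y. N p (y - x) < e - N p (x - z)}"
        then show "y \<in> s"
          using cnorm_triangle[OF is_cnorm, of p y z x] unfolding s(1) by simp
      qed
      ultimately show "\<exists>p e. e > 0 \<and> {y. N p (y - x) < e} \<subseteq> s" by blast
    qed
  qed
  then show ?thesis using x by blast
qed

theorem cn_dual_eq_Union: "cn_dual scale N = (\<Union>p. banach_dual scale (N p))"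
proof (intro equalityI subsetI)
  fix f assume f: "f \<in> cn_dual scale N"
  then have lf: "linear_form_on scale UNIV f"
    and cf: "continuous_map (seminorm_topology UNIV (range N)) euclidean f"
    unfolding cn_dual_def lc_dual_def by auto
  have f0: "f 0 = 0" using linear_form_diff[OF lf, of 0 0] by simp
  have "openin (seminorm_topology UNIV (range N))
      {x \<in> topspace (seminorm_topology UNIV (range N)). f x \<in> ball 0 1}"
    by (rule openin_continuous_map_preimage[OF cf]) simp
  moreover have "0 \<in> {x \<in> topspace (seminorm_topology UNIV (range N)). f x \<in> ball 0 1}"
    by (simp add: topspace_seminorm_topology f0)
  ultimately obtain p e where e: "e > 0"
      "{y. N p (y - 0) < e} \<subseteq> {x \<in> topspace (seminorm_topology UNIV (range N)). f x \<in> ball 0 1}"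
    using seminorm_open_contains_ball by blast
  have "cmod (f x) \<le> 2 / e * N p x" for x
  proof (cases "x = 0")
    case True
    then show ?thesis using f0 cnormD(2)[OF is_cnorm, of p 0] by simp
  next
    case False
    then have pos: "N p x > 0"
      using cnormD(1,2)[OF is_cnorm, of p x] by (simp add: less_le)
    let ?c = "complex_of_real (e / (2 * N p x))"
    have "N p (scale ?c x) = cmod ?c * N p x" by (rule cnormD(4)[OF is_cnorm])
    also have "\<dots> = e / 2" using pos e(1) by (simp add: norm_divide norm_mult)
    finally have "N p (scale ?c x - 0) < e" using e(1) by simp
    then have "scale ?c x \<in> {x \<in> topspace (seminorm_topology UNIV (range N)). f x \<in> ball 0 1}"
      using e(2) by blast
    then have "cmod (f (scale ?c x)) < 1" by simp
    moreover have "f (scale ?c x) = ?c * f x" using lf unfolding linear_form_on_def by blast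
    then have "cmod (f (scale ?c x)) = e / (2 * N p x) * cmod (f x)"
      using pos e(1) by (simp add: norm_mult norm_divide)
    ultimately have "e / (2 * N p x) * cmod (f x) \<le> 1" by linarith
    then show ?thesis using pos e(1) by (simp add: field_simps)
  qed
  then show "f \<in> (\<Union>p. banach_dual scale (N p))"
    unfolding banach_dual_def using lf by blast
next
  fix f assume "f \<in> (\<Union>p. banach_dual scale (N p))"
  then obtain p where f: "f \<in> banach_dual scale (N p)" by blast
  then have lf: "linear_form_on scale UNIV f" unfolding banach_dual_def by blast
  obtain C where C: "C > 0" "\<And>x. cmod (f x) \<le> C * N p x"
    using banach_dual_bound[OF is_cnorm f] by blast
  have "continuous_map (seminorm_topology UNIV (range N)) euclidean f"
    unfolding continuous_map_def topspace_seminorm_topology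
  proof (intro conjI allI impI)
    fix U :: "complex set" assume "openin euclidean U"
    then have U: "open U" by simp
    show "openin (seminorm_topology UNIV (range N)) {x \<in> UNIV. f x \<in> U}"
    proof (subst openin_subopen, intro ballI)
      fix x assume "x \<in> {x \<in> UNIV. f x \<in> U}"
      then obtain e where e: "e > 0" "ball (f x) e \<subseteq> U"
        using U open_contains_ball_eq by (metis (lifting) mem_Collect_eq)
      have "f y \<in> U" if "N p (y - x) < e / C" for y
      proof -
        have "cmod (f y - f x) \<le> C * N p (y - x)"
          using C(2)[of "y - x"] by (simp add: linear_form_diff[OF lf])
        also have "\<dots> < e" using that C(1) by (simp add: field_simps)
        finally show ?thesis using e(2) by (auto simp: dist_norm norm_minus_commute)
      qed
      then show "\<exists>T. openin (seminorm_topology UNIV (range N)) T \<and> x \<in> T \<and>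
          T \<subseteq> {x \<in> UNIV. f x \<in> U}"
        using openin_ball[of "e / C" p x] centre_in_ball[of "e / C" x p] e(1) C(1)
        by (intro exI[of _ "{y. N p (y - x) < e / C}"]) auto
    qed
  qed auto
  then show "f \<in> cn_dual scale N"
    unfolding cn_dual_def lc_dual_def using lf by simp
qed

end

end

theory Submission
  imports Defs
begin

text \<open>
  With \<open>r = A p q * dual_norm (N q) a\<close>, the strong algebra inequality gives by induction that
  the \<open>n\<close>-th power of \<open>a\<close> has \<open>p\<close>-th dual norm at most \<open>r ^ n\<close> times that of the unit. Since
  \<open>r < R\<close>, the terms of the series are norm summable in the Banach dual. Norm summable series
  converge there, and the sum is the pointwise one.
\<close>

lemma sum_fun_apply: "(\<Sum>k\<in>K. t k) x = (\<Sum>k\<in>K. (t k :: 'a \<Rightarrow> complex) x)"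
  by (induction K rule: infinite_finite_induct) auto

text \<open>Membership in the Banach dual makes the supremum a bounded one; the vector
  \<open>0\<close> lies in the unit ball and supplies a nonnegative value below it.\<close>

lemma dual_norm_nonneg:
  assumes "is_cnorm scl N" "f \<in> banach_dual scl N"
  shows "0 \<le> dual_norm N f"
proof -
  have "N 0 = 0"
    using cnormD(2)[OF assms(1)] by simp
  then show ?thesis
    unfolding dual_norm_def
    by (intro cSUP_upper2[where x = 0] bdd_above_dual_norm[OF assms]) auto
qed

lemma fscale_banach_dual:
  assumes "f \<in> banach_dual scl N"
  shows "fscale z f \<in> banach_dual scl N"
proof -
  obtain C where C: "\<And>x. cmod (f x) \<le> C * N x"
    using assms unfolding banach_dual_def by blast
  have "cmod (fscale z f x) \<le> (cmod z * C) * N x" for x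
    using mult_left_mono[OF C[of x], of "cmod z"] by (simp add: fscale_def norm_mult mult.assoc)
  moreover have "linear_form_on scl UNIV (fscale z f)"
    using assms by (simp add: banach_dual_def linear_form_on_def fscale_def algebra_simps)
  ultimately show ?thesis
    unfolding banach_dual_def by blast
qed

lemma dual_norm_fscale_le:
  assumes "vector_space scl" "is_cnorm scl N" "f \<in> banach_dual scl N"
  shows "dual_norm N (fscale z f) \<le> cmod z * dual_norm N f"
proof (rule dual_norm_le[where ?x0.0 = 0])
  show "cmod (fscale z f x) \<le> cmod z * dual_norm N f * N x" for x
    using mult_left_mono[OF cmod_le_dual_norm[OF assms, of x], of "cmod z"]
    by (simp add: fscale_def norm_mult mult.assoc)
  show "0 \<le> cmod z * dual_norm N f"
    using dual_norm_nonneg[OF assms(2,3)] by simp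
  show "N 0 \<le> 1"
    using cnormD(2)[OF assms(2), of 0] by simp
qed

text \<open>Absolute convergence in the dual norm gives convergence. The limit is built pointwise,
  and the tails of the series of dual norms control the error uniformly on the unit ball.\<close>

lemma banach_dual_sums_pointwise:
  assumes vs: "vector_space scl" and cn: "is_cnorm scl N"
    and t: "\<And>n. t n \<in> banach_dual scl N" and summ: "summable (\<lambda>n. dual_norm N (t n))"
  shows "banach_dual_sums scl N t (\<lambda>x. \<Sum>n. t n x)"
proof -
  define s where "s = (\<lambda>x. \<Sum>n. t n x)"
  define D where "D = (\<lambda>n. dual_norm N (t n))"
  have lin: "t n (x + y) = t n x + t n y" "t n (scl z x) = z * t n x" for n x y z
    using t[of n] unfolding banach_dual_def linear_form_on_def by blast+
  have sumD: "summable (\<lambda>k. D (k + n))" for n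
    using summ unfolding D_def by (rule summable_ignore_initial_segment)
  have le: "norm (t n x) \<le> D n * N x" for n x
    unfolding D_def by (rule cmod_le_dual_norm[OF vs cn t])
  have sumt: "summable (\<lambda>n. t n x)" for x
    by (rule summable_comparison_test'[where N = 0 and g = "\<lambda>n. D n * N x"])
      (use le sumD[of 0] in \<open>auto intro: summable_mult2\<close>)
  \<comment> \<open>This estimate serves twice: \<open>n = 0\<close> shows that \<open>s\<close> is
    a bounded functional, and general \<open>n\<close> gives convergence in the dual norm.\<close>
  have tail: "cmod (s x - (\<Sum>k<n. t k x)) \<le> (\<Sum>k. D (k + n)) * N x" for x n
  proof -
    have "s x - (\<Sum>k<n. t k x) = (\<Sum>k. t (k + n) x)"
      unfolding s_def by (simp add: suminf_minus_initial_segment[OF sumt])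
    also have "cmod \<dots> \<le> (\<Sum>k. D (k + n) * N x)"
      by (rule norm_suminf_le) (use le sumD in \<open>auto intro: summable_mult2\<close>)
    also have "\<dots> = (\<Sum>k. D (k + n)) * N x"
      by (rule suminf_mult2[symmetric, OF sumD])
    finally show ?thesis .
  qed
  have "cmod (s x) \<le> (\<Sum>k. D k) * N x" for x
    using tail[of x 0] by simp
  moreover have "s (x + y) = s x + s y" "s (scl z x) = z * s x" for x y z
    by (simp_all add: s_def lin suminf_add suminf_mult sumt)
  ultimately have "s \<in> banach_dual scl N"
    unfolding banach_dual_def linear_form_on_def by blast
  moreover have "norm_LIMSEQ (dual_norm N) (\<lambda>n. \<Sum>k<n. t k) s"
    unfolding norm_LIMSEQ_def
  proof (rule tendsto_sandwich)
    let ?E = "\<lambda>n. (\<Sum>k<n. t k) - s"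
    have E: "cmod (?E n x) \<le> (\<Sum>k. D (k + n)) * N x" for n x
      using tail[of x n] by (simp add: sum_fun_apply norm_minus_commute)
    \<comment> \<open>The lower half of the sandwich rests on \<open>dual_norm_nonneg\<close>, so
      the error \<open>?E n\<close> has to be placed in the Banach dual first.\<close>
    have "linear_form_on scl UNIV (?E n)" for n
      using \<open>s \<in> banach_dual scl N\<close>
      by (auto simp: linear_form_on_def banach_dual_def sum_fun_apply lin sum.distrib
          sum_distrib_left algebra_simps)
    with E have "?E n \<in> banach_dual scl N" for n
      unfolding banach_dual_def by blast
    then show "\<forall>\<^sub>F n in sequentially. 0 \<le> dual_norm N (?E n)"
      by (intro always_eventually allI dual_norm_nonneg[OF cn])
    have "0 \<le> (\<Sum>k. D (k + n))" for n
      by (rule suminf_nonneg[OF sumD]) (simp add: D_def dual_norm_nonneg[OF cn t])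
    moreover have "N 0 \<le> 1"
      using cnormD(2)[OF cn, of 0] by simp
    ultimately show "\<forall>\<^sub>F n in sequentially. dual_norm N (?E n) \<le> (\<Sum>k. D (k + n))"
      using E by (intro always_eventually allI dual_norm_le[where ?x0.0 = 0])
    show "(\<lambda>n. \<Sum>k. D (k + n)) \<longlonglongrightarrow> 0"
      using summ unfolding D_def by (rule suminf_exist_split2)
  qed simp
  ultimately show ?thesis
    unfolding banach_dual_sums_def s_def using t by blast
qed

context strong_algebra
begin

text \<open>Each step multiplies by \<open>a\<close> on the left, with \<open>a\<close> measured in
  the \<open>q\<close>-th norm and the previous power in the \<open>p\<close>-th. Hence every
  multiplication costs one factor \<open>A p q * dual_norm (N q) a\<close>, and the index
  \<open>p\<close> never grows.\<close>

lemma alg_power_banach_dual: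
  assumes pq: "real p > real q + d" and a: "a \<in> banach_dual scale (N q)"
    and u: "u \<in> banach_dual scale (N p)"
  shows "alg_power mult u a n \<in> banach_dual scale (N p) \<and>
    dual_norm (N p) (alg_power mult u a n) \<le>
      (A p q * dual_norm (N q) a) ^ n * dual_norm (N p) u"
proof (induction n)
  case (Suc n)
  let ?r = "A p q * dual_norm (N q) a"
  have "0 \<le> ?r"
    using A_pos[OF pq] dual_norm_nonneg[OF is_cnorm a] by simp
  then have "?r * dual_norm (N p) (alg_power mult u a n) \<le> ?r * (?r ^ n * dual_norm (N p) u)"
    using Suc by (intro mult_left_mono) auto
  with mult_le[OF pq a, of "alg_power mult u a n"] Suc show ?case
    by (auto simp: mult.assoc)
qed (use u in simp)

end

text \<open>The term with index \<open>0\<close> is \<open>fscale (c 0) unit\<close>, which is why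
  \<open>unit\<close> is placed in the \<open>p\<close>-th dual. Taking \<open>R\<close> in
  \<open>ereal\<close> admits an infinite radius.\<close>

theorem theorem2p5:
  fixes scale :: "complex \<Rightarrow> 'a::ab_group_add \<Rightarrow> 'a"
    and N :: "nat \<Rightarrow> 'a \<Rightarrow> real"
    and mult :: "('a \<Rightarrow> complex) \<Rightarrow> ('a \<Rightarrow> complex) \<Rightarrow> ('a \<Rightarrow> complex)"
    and unit a :: "'a \<Rightarrow> complex"
    and d :: real
    and A :: "nat \<Rightarrow> nat \<Rightarrow> real"
    and c :: "nat \<Rightarrow> complex"
    and R :: ereal
    and p q :: nat
  assumes "unital_strong_algebra scale N mult d A unit"
    and "\<And>z. ereal (cmod z) < R \<Longrightarrow> summable (\<lambda>n. c n * z ^ n)"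
    and "a \<in> cn_dual scale N"
    and "real p > real q + d"
    and "a \<in> banach_dual scale (N q)"
    and "ereal (A p q * dual_norm (N q) a) < R"
    and "unit \<in> banach_dual scale (N p)"
  shows "(\<exists>s. banach_dual_sums scale (N p) (\<lambda>n. fscale (c n) (alg_power mult unit a n)) s \<and>
              s \<in> banach_dual scale (N p)) \<and>
         banach_dual scale (N p) \<subseteq> cn_dual scale N"
proof -
  interpret unital_strong_algebra scale N mult d A unit by fact
  define r where "r = A p q * dual_norm (N q) a"
  have "0 \<le> r"
    using A_pos[OF assms(4)] dual_norm_nonneg[OF is_cnorm assms(5)] by (simp add: r_def)
  \<comment> \<open>A power series converges absolutely at \<open>r\<close> once it converges at a
    point of larger modulus, so a real \<open>\<rho>\<close> is inserted strictly between
    \<open>r\<close> and \<open>R\<close>.\<close>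
  obtain \<rho> where \<rho>: "r < \<rho>" "ereal \<rho> < R"
    using ereal_dense2[of "ereal r" R] assms(6) by (auto simp: r_def)
  have "summable (\<lambda>n. c n * of_real \<rho> ^ n)"
    using assms(2)[of "of_real \<rho>"] \<rho> \<open>0 \<le> r\<close> by simp
  then have "summable (\<lambda>n. norm (c n * of_real r ^ n))"
    by (rule powser_insidea) (use \<rho> \<open>0 \<le> r\<close> in simp)
  \<comment> \<open>The dual norm of \<open>unit\<close> enters as a factor constant in
    \<open>n\<close>: it is the base value of the bound on the powers of \<open>a\<close>.\<close>
  then have major: "summable (\<lambda>n. cmod (c n) * r ^ n * dual_norm (N p) unit)"
    using \<open>0 \<le> r\<close> by (intro summable_mult2) (simp add: norm_mult norm_power)
  let ?t = "\<lambda>n. fscale (c n) (alg_power mult unit a n)"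
  note pow = alg_power_banach_dual[OF assms(4,5,7), folded r_def]
  have t: "?t n \<in> banach_dual scale (N p)" for n
    using pow by (intro fscale_banach_dual) blast
  have "dual_norm (N p) (?t n) \<le> cmod (c n) * r ^ n * dual_norm (N p) unit" for n
  proof -
    have "dual_norm (N p) (?t n) \<le> cmod (c n) * dual_norm (N p) (alg_power mult unit a n)"
      using pow by (intro dual_norm_fscale_le[OF vector_space_axioms is_cnorm]) blast
    also have "\<dots> \<le> cmod (c n) * (r ^ n * dual_norm (N p) unit)"
      using pow by (intro mult_left_mono) auto
    finally show ?thesis by (simp add: mult.assoc)
  qed
  then have "summable (\<lambda>n. dual_norm (N p) (?t n))"
    using dual_norm_nonneg[OF is_cnorm t]
    by (intro summable_comparison_test'[OF major, where N = 0]) auto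
  from banach_dual_sums_pointwise[OF vector_space_axioms is_cnorm t this]
  show ?thesis
    unfolding cn_dual_eq_Union banach_dual_sums_def by blast
qed

end
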